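(* Let $A$ be a state feedback matrix whose S-IDNC graph $\mathcal G_s$ has $K$ vertices and $M_0$ edges, and let $U_s$ be the absolute minimum block completion time of S-IDNC for $A$. Then $$U_s\leqslant\begin{cases}K,& M_0=0,\\ K-1,& 1\le M_0\le K-1,\\ K-2,& K\le M_0\le 2K-3,\\ \ \ \vdots & \ \ \vdots\\ 1,& M_0=K(K-1)/2,\end{cases}$$ that is, for each integer $1\le j\le K-1$, if $\sum_{i=1}^{j-1}(K-i)+1\le M_0\le\sum_{i=1}^{j}(K-i)$ then $U_s\le K-j$ (and $U_s\le K$ if $M_0=0$).
   Context: Let $\mathbf p_1,\dots,\mathbf p_K$ be data packets and $R_1,\dots,R_N$ receivers. The state feedback matrix $A\in\{0,1\}^{N\times K}$ has $a_{n,k}=1$ if $R_n$ wants $\mathbf p_k$ and $a_{n,k}=0$ if $R_n$ already has it; $\mathcal W_n=\{\mathbf p_k:a_{n,k}=1\}$ is the Wants set of $R_n$. Two distinct packets conflict if some receiver wants both (both lie in $\mathcal W_n$ for some $n$). The S-IDNC graph $\mathcal G_s$ is the undirected graph with one vertex per data packet, two distinct vertices being joined by an edge iff the corresponding packets do not conflict. An S-IDNC coding set is a set of pairwise non-conflicting packets, i.e. a clique of $\mathcal G_s$; its coded packet is the binary XOR of its members. An S-IDNC solution is a collection of coding sets such that, upon reception of all their coded packets, every receiver can decode all its wanted packets (i.e. every packet wanted by some receiver lies in at least one coding set). $U_s$ is the minimum number of coding sets in an S-IDNC solution of $A$. *)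

theory Defs
  imports "HOL-Library.Ramsey" "HOL-Library.Z2" "Jordan_Normal_Form.Matrix"
begin

text \<open>Receivers and packets are indexed from 0: row \<open>n\<close> is a receiver, column \<open>k\<close> a packet.\<close>

definition state_feedback_matrix :: "nat \<Rightarrow> nat \<Rightarrow> nat mat \<Rightarrow> bool" where
  "state_feedback_matrix N K A \<longleftrightarrow> A \<in> carrier_mat N K \<and> elements_mat A \<subseteq> {0, 1}"

definition wants :: "nat mat \<Rightarrow> nat \<Rightarrow> nat set" where
  "wants A n = {k. k < dim_col A \<and> A $$ (n, k) = 1}"

definition conflict :: "nat mat \<Rightarrow> nat \<Rightarrow> nat \<Rightarrow> bool" where
  "conflict A j k \<longleftrightarrow> j \<noteq> k \<and> (\<exists>n<dim_row A. j \<in> wants A n \<and> k \<in> wants A n)"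

definition sidnc_vertices :: "nat mat \<Rightarrow> nat set" where
  "sidnc_vertices A = {..<dim_col A}"

definition sidnc_edges :: "nat mat \<Rightarrow> nat set set" where
  "sidnc_edges A =
    {{j, k} | j k. j \<in> sidnc_vertices A \<and> k \<in> sidnc_vertices A \<and> j \<noteq> k \<and> \<not> conflict A j k}"

definition coding_set :: "nat mat \<Rightarrow> nat set \<Rightarrow> bool" where
  "coding_set A S \<longleftrightarrow> S \<subseteq> sidnc_vertices A \<and> clique S (sidnc_edges A)"

definition sidnc_solution :: "nat mat \<Rightarrow> nat set set \<Rightarrow> bool" where
  "sidnc_solution A C \<longleftrightarrow>
    (\<forall>S\<in>C. coding_set A S) \<and> (\<forall>n<dim_row A. \<forall>k\<in>wants A n. \<exists>S\<in>C. k \<in> S)"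

text \<open>A solution is a set of subsets of a finite set, hence finite, so \<^const>\<open>card\<close> really counts.\<close>

definition U_s :: "nat mat \<Rightarrow> nat" where
  "U_s A = (LEAST u. \<exists>C. sidnc_solution A C \<and> card C = u)"

lemma coding_set_iff_no_conflict:
  "coding_set A S \<longleftrightarrow> S \<subseteq> {..<dim_col A} \<and> (\<forall>j\<in>S. \<forall>k\<in>S. \<not> conflict A j k)"
proof -
  have "{j, k} \<in> sidnc_edges A \<longleftrightarrow> \<not> conflict A j k"
    if "S \<subseteq> {..<dim_col A}" "j \<in> S" "k \<in> S" "j \<noteq> k" for j k
  proof
    assume "{j, k} \<in> sidnc_edges A"
    then obtain a b where "{j, k} = {a, b}" "\<not> conflict A a b"
      by (auto simp: sidnc_edges_def)
    then show "\<not> conflict A j k"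
      unfolding doubleton_eq_iff by (auto simp: conflict_def)
  next
    assume "\<not> conflict A j k"
    then show "{j, k} \<in> sidnc_edges A"
      using that unfolding sidnc_edges_def sidnc_vertices_def by blast
  qed
  moreover have "\<not> conflict A j j" for j by (simp add: conflict_def)
  ultimately show ?thesis
    unfolding coding_set_def clique_def sidnc_vertices_def by metis
qed

lemma finite_sidnc_solution:
  assumes "sidnc_solution A C" shows "finite C"
proof (rule finite_subset)
  show "C \<subseteq> Pow {..<dim_col A}"
    using assms by (auto simp: sidnc_solution_def coding_set_def sidnc_vertices_def)
qed simp

lemma U_s_attained: "\<exists>C. sidnc_solution A C \<and> card C = U_s A"
proof -
  let ?C = "(\<lambda>k. {k}) ` {..<dim_col A}"
  have "coding_set A {k}" if "k < dim_col A" for k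
    using that unfolding coding_set_def sidnc_vertices_def clique_def by simp
  then have "\<forall>S\<in>?C. coding_set A S" by blast
  moreover have "\<exists>S\<in>?C. k \<in> S" if "k \<in> wants A n" for n k
    using that unfolding wants_def by blast
  ultimately have "sidnc_solution A ?C"
    unfolding sidnc_solution_def by (intro conjI allI impI ballI) fast+
  then have "\<exists>C. sidnc_solution A C \<and> card C = card ?C"
    by (intro exI[of _ ?C] conjI refl)
  then show ?thesis
    unfolding U_s_def by (rule LeastI)
qed

text \<open>
  The covering condition in \<^const>\<open>sidnc_solution\<close> agrees with decodability: the packets a receiver
  already has, together with the XORs of all coding sets, determine every packet it wants.
  XOR acts bitwise, so a packet is modelled by a single bit, and XOR is addition in \<^typ>\<open>bit\<close>.
\<close>

lemma sidnc_solution_iff_decodable: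
  assumes C: "\<forall>S\<in>C. coding_set A S"
  shows "sidnc_solution A C \<longleftrightarrow>
    (\<forall>n<dim_row A. \<forall>k\<in>wants A n. \<forall>p q :: nat \<Rightarrow> bit.
      (\<forall>i\<in>{..<dim_col A} - wants A n. p i = q i) \<longrightarrow>
      (\<forall>S\<in>C. (\<Sum>i\<in>S. p i) = (\<Sum>i\<in>S. q i)) \<longrightarrow> p k = q k)"
    (is "_ \<longleftrightarrow> ?D")
proof
  assume sol: "sidnc_solution A C"
  show ?D
  proof (intro allI ballI impI)
    fix n k and p q :: "nat \<Rightarrow> bit"
    assume n: "n < dim_row A" and k: "k \<in> wants A n"
      and has: "\<forall>i\<in>{..<dim_col A} - wants A n. p i = q i"
      and eq: "\<forall>S\<in>C. (\<Sum>i\<in>S. p i) = (\<Sum>i\<in>S. q i)"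
    obtain S where S: "S \<in> C" "k \<in> S"
      using sol n k unfolding sidnc_solution_def by blast
    have cs: "S \<subseteq> {..<dim_col A}" "\<forall>i\<in>S. \<not> conflict A i k"
      using C S unfolding coding_set_iff_no_conflict by blast+
    have fin: "finite S" using cs(1) finite_subset by blast
    have "p i = q i" if "i \<in> S - {k}" for i
    proof -
      from that have "i \<in> S" "i \<noteq> k" by simp_all
      then have "i \<notin> wants A n"
        using cs(2) n k unfolding conflict_def by metis
      then show ?thesis using has cs(1) \<open>i \<in> S\<close> by (meson DiffI subsetD)
    qed
    then have "(\<Sum>i\<in>S - {k}. p i) = (\<Sum>i\<in>S - {k}. q i)"
      by (rule sum.cong[OF refl])
    moreover have "(\<Sum>i\<in>S. p i) = (\<Sum>i\<in>S. q i)" using eq S(1) by (rule bspec)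
    ultimately show "p k = q k"
      using sum.remove[OF fin S(2), of p] sum.remove[OF fin S(2), of q]
      by (metis add_right_cancel)
  qed
next
  assume D: ?D
  have "\<exists>S\<in>C. k \<in> S" if n: "n < dim_row A" and k: "k \<in> wants A n" for n k
  proof (rule ccontr)
    assume no: "\<not> (\<exists>S\<in>C. k \<in> S)"
    define p q :: "nat \<Rightarrow> bit" where "p = (\<lambda>_. 0)" and "q = (\<lambda>i. if i = k then 1 else 0)"
    have "(\<Sum>i\<in>S. p i) = (\<Sum>i\<in>S. q i)" if "S \<in> C" for S
    proof (rule sum.cong[OF refl])
      fix i assume "i \<in> S"
      then have "i \<noteq> k" using no that by metis
      then show "p i = q i" by (simp add: p_def q_def)
    qed
    moreover have "\<forall>i\<in>{..<dim_col A} - wants A n. p i = q i"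
      using k by (metis DiffD2 p_def q_def)
    ultimately have "p k = q k"
      using D[rule_format, OF n k, of p q] by blast
    then show False by (simp add: p_def q_def)
  qed
  then show "sidnc_solution A C" using C unfolding sidnc_solution_def by blast
qed

end

theory Submission imports Defs begin

text \<open>
  A clique cover of the S-IDNC graph is a proper colouring of the conflict graph. Greedy colouring
  opens a new colour \<open>c\<close> only for a vertex adjacent to all \<open>c\<close> previous colour classes, so using
  \<open>c\<close> colours requires at least \<open>0 + 1 + \<dots> + (c - 1)\<close> conflicts. Since there are
  \<open>K(K - 1)/2 - M\<^sub>0\<close> conflicts, few of them force few colours.
\<close>

lemma greedy_colouring:
  assumes "finite V"
  shows "\<exists>(f :: 'a \<Rightarrow> nat) c. f ` V = {..<c}
    \<and> (\<forall>x\<in>V. \<forall>y\<in>V. x \<noteq> y \<longrightarrow> f x = f y \<longrightarrow> {x, y} \<notin> E)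
    \<and> c choose 2 \<le> card (E \<inter> nsets V 2)"
  using assms
proof (induction V rule: finite_induct)
  case empty
  show ?case by (intro exI[of _ "\<lambda>_. 0"] exI[of _ 0]) (simp add: numeral_2_eq_2)
next
  case (insert v V)
  then obtain f :: "'a \<Rightarrow> nat" and c where f: "f ` V = {..<c}"
    and proper: "\<forall>x\<in>V. \<forall>y\<in>V. x \<noteq> y \<longrightarrow> f x = f y \<longrightarrow> {x, y} \<notin> E"
    and edges: "c choose 2 \<le> card (E \<inter> nsets V 2)"
    by blast
  have fin: "finite (E \<inter> nsets (insert v V) 2)"
    using insert.hyps(1) by (simp add: finite_imp_finite_nsets)
  have mono: "E \<inter> nsets V 2 \<subseteq> E \<inter> nsets (insert v V) 2"
    by (auto simp: nsets_def)
  \<comment> \<open>The colour \<open>i\<close> of the new vertex stays a parameter, so that the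
    next facts serve both the reuse of an old colour and the opening of colour
    \<open>c\<close>.\<close>
  have upd: "(f(v := i)) x = f x" if "x \<in> V" for i x
    using that insert.hyps(2) by auto
  then have img: "(f(v := i)) ` insert v V = insert i {..<c}" for i
    using f insert.hyps(2) by (auto simp: image_iff)
  have proper_upd: "\<forall>x\<in>insert v V. \<forall>y\<in>insert v V.
      x \<noteq> y \<longrightarrow> (f(v := i)) x = (f(v := i)) y \<longrightarrow> {x, y} \<notin> E"
    if "\<forall>w\<in>V. f w = i \<longrightarrow> {v, w} \<notin> E" for i
    using that proper by (auto simp: insert_commute)
  show ?case
  proof (cases "\<exists>i<c. \<forall>w\<in>V. f w = i \<longrightarrow> {v, w} \<notin> E")
    case True
    then obtain i where i: "i < c" "\<forall>w\<in>V. f w = i \<longrightarrow> {v, w} \<notin> E" by blast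
    then have "(f(v := i)) ` insert v V = {..<c}" using img[of i] by auto
    moreover have "c choose 2 \<le> card (E \<inter> nsets (insert v V) 2)"
      using edges card_mono[OF fin mono] by linarith
    ultimately show ?thesis using proper_upd[OF i(2)] by blast
  next
    case False
    \<comment> \<open>Every old colour is blocked: \<open>w i\<close> is a neighbour of
      \<open>v\<close> in class \<open>i\<close>. Different classes give different neighbours, hence
      \<open>c\<close> new edges at \<open>v\<close>.\<close>
    then obtain w where w: "\<And>i. i < c \<Longrightarrow> w i \<in> V \<and> f (w i) = i \<and> {v, w i} \<in> E"
      by metis
    define W where "W = (\<lambda>i. {v, w i}) ` {..<c}"
    have "inj_on (\<lambda>i. {v, w i}) {..<c}"
      by (rule inj_onI) (metis doubleton_eq_iff lessThan_iff w)
    then have cardW: "card W = c" by (simp add: W_def card_image)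
    have disj: "E \<inter> nsets V 2 \<inter> W = {}"
      using insert.hyps(2) by (auto simp: W_def nsets_def)
    have "W \<subseteq> E \<inter> nsets (insert v V) 2"
      using w insert.hyps(2) by (fastforce simp: W_def)
    then have "card ((E \<inter> nsets V 2) \<union> W) \<le> card (E \<inter> nsets (insert v V) 2)"
      using mono by (intro card_mono[OF fin]) blast
    moreover have "card ((E \<inter> nsets V 2) \<union> W) = card (E \<inter> nsets V 2) + c"
      using disj cardW finite_subset[OF mono fin]
      by (subst card_Un_disjoint) (simp_all add: W_def)
    \<comment> \<open>Pascal's rule: going from \<open>c\<close> to \<open>Suc c\<close> colours
      raises the bound by exactly the \<open>c\<close> edges in \<open>W\<close>.\<close>
    ultimately have "Suc c choose 2 \<le> card (E \<inter> nsets (insert v V) 2)"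
      using edges by (simp add: numeral_2_eq_2)
    moreover have "(f(v := c)) ` insert v V = {..<Suc c}"
      using img[of c] by (simp add: lessThan_Suc)
    moreover have "\<forall>w\<in>V. f w = c \<longrightarrow> {v, w} \<notin> E" using f by blast
    ultimately show ?thesis using proper_upd[of c] by blast
  qed
qed

text \<open>Count the pairs of \<open>K\<close> points by their earlier point: the
  \<open>i\<close>-th point has \<open>K - i\<close> later partners, and the pairs avoiding the
  first \<open>j\<close> points lie among the other \<open>K - j\<close>. This turns the thresholds
  on the edge number into binomials.\<close>

lemma sum_diff_plus_choose_two:
  fixes K j :: nat
  assumes "j \<le> K"
  shows "(\<Sum>i = 1..j. K - i) + ((K - j) choose 2) = K choose 2"
  using assms
proof (induction j)
  case (Suc j)
  then have "K - j = Suc (K - Suc j)" by linarith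
  then have "(K - j) choose 2 = (K - Suc j) + ((K - Suc j) choose 2)"
    by (simp only: numeral_2_eq_2 binomial_Suc_Suc) simp
  with Suc show ?case by simp
qed simp

lemma sidnc_edges_subset_nsets: "sidnc_edges A \<subseteq> nsets (sidnc_vertices A) 2"
  by (auto simp: sidnc_edges_def)

lemma U_s_le_colours:
  fixes f :: "nat \<Rightarrow> nat"
  assumes img: "f ` sidnc_vertices A \<subseteq> {..<c}"
    and proper: "\<And>x y. \<lbrakk>x \<in> sidnc_vertices A; y \<in> sidnc_vertices A; x \<noteq> y; f x = f y\<rbrakk>
      \<Longrightarrow> {x, y} \<in> sidnc_edges A"
  shows "U_s A \<le> c"
proof -
  define C where "C = (\<lambda>i. {x \<in> sidnc_vertices A. f x = i}) ` {..<c}"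
  have "\<exists>S\<in>C. k \<in> S" if "k \<in> wants A n" for n k
    using that img by (auto simp: C_def wants_def sidnc_vertices_def)
  moreover have "\<forall>S\<in>C. coding_set A S"
    using proper by (auto simp: C_def coding_set_def clique_def)
  ultimately have "sidnc_solution A C"
    unfolding sidnc_solution_def by blast
  then have "U_s A \<le> card C"
    unfolding U_s_def by (intro Least_le) blast
  \<comment> \<open>Only an inequality: empty colour classes coincide as sets.\<close>
  also have "\<dots> \<le> c"
    unfolding C_def using card_image_le[of "{..<c}"] by simp
  finally show ?thesis .
qed

lemma U_s_choose_two_bound:
  assumes "card (sidnc_vertices A) = K"
  shows "U_s A \<le> K" and "\<exists>c\<ge>U_s A. (c choose 2) + card (sidnc_edges A) \<le> K choose 2"
proof -
  let ?V = "sidnc_vertices A" and ?E = "sidnc_edges A"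
  have finV: "finite ?V" by (simp add: sidnc_vertices_def)
  \<comment> \<open>Within \<open>nsets ?V 2\<close>, the complement \<open>- ?E\<close> is the
    conflict graph, so colour classes are cliques of the S-IDNC graph.\<close>
  obtain f :: "nat \<Rightarrow> nat" and c where f: "f ` ?V = {..<c}"
    and proper: "\<forall>x\<in>?V. \<forall>y\<in>?V. x \<noteq> y \<longrightarrow> f x = f y \<longrightarrow> {x, y} \<notin> - ?E"
    and edges: "c choose 2 \<le> card (- ?E \<inter> nsets ?V 2)"
    using greedy_colouring[OF finV, of "- ?E"] by blast
  have U: "U_s A \<le> c"
    using f proper by (intro U_s_le_colours) auto
  \<comment> \<open>All \<open>c\<close> colours are actually used on the \<open>K\<close>
    vertices.\<close>
  have "c \<le> K"
    using card_image_le[OF finV, of f] f assms by simp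
  with U show "U_s A \<le> K" by simp
  have finE: "finite (nsets ?V 2)" using finV by (rule finite_imp_finite_nsets)
  have "- ?E \<inter> nsets ?V 2 = nsets ?V 2 - ?E" by blast
  then have "card (- ?E \<inter> nsets ?V 2) = (K choose 2) - card ?E"
    using card_Diff_subset[OF finite_subset[OF sidnc_edges_subset_nsets finE] sidnc_edges_subset_nsets] assms
    by simp
  moreover have "card ?E \<le> K choose 2"
    using card_mono[OF finE sidnc_edges_subset_nsets] assms by simp
  ultimately have "(c choose 2) + card ?E \<le> K choose 2" using edges by linarith
  with U show "\<exists>c\<ge>U_s A. (c choose 2) + card ?E \<le> K choose 2" by blast
qed

theorem mainTheorem4:
  fixes A :: "nat mat" and N K M\<^sub>0 :: nat
  assumes "state_feedback_matrix N K A"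
    and "card (sidnc_vertices A) = K"
    and "card (sidnc_edges A) = M\<^sub>0"
  shows "(M\<^sub>0 = 0 \<longrightarrow> U_s A \<le> K) \<and>
    (\<forall>j. 1 \<le> j \<and> j \<le> K - 1 \<and> (\<Sum>i = 1..j - 1. K - i) + 1 \<le> M\<^sub>0 \<and> M\<^sub>0 \<le> (\<Sum>i = 1..j. K - i)
      \<longrightarrow> U_s A \<le> K - j)"
proof (intro conjI allI impI)
  show "U_s A \<le> K" using U_s_choose_two_bound(1)[OF assms(2)] .
next
  fix j
  assume j: "1 \<le> j \<and> j \<le> K - 1 \<and> (\<Sum>i = 1..j - 1. K - i) + 1 \<le> M\<^sub>0 \<and> M\<^sub>0 \<le> (\<Sum>i = 1..j. K - i)"
  obtain c where c: "U_s A \<le> c" "(c choose 2) + M\<^sub>0 \<le> K choose 2"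
    using U_s_choose_two_bound(2)[OF assms(2)] assms(3) by blast
  show "U_s A \<le> K - j"
  proof (rule ccontr)
    assume "\<not> U_s A \<le> K - j"
    \<comment> \<open>Since \<open>1 \<le> j \<le> K - 1\<close>, no subtraction truncates and
      \<open>K - (j - 1)\<close> is \<open>K - j + 1\<close>. That many colours leave at most the
      sum up to \<open>j - 1\<close> for \<open>M\<^sub>0\<close>, one less than its lower
      bound.\<close>
    then have "K - (j - 1) \<le> c" using c(1) j by linarith
    then have "(K - (j - 1)) choose 2 \<le> c choose 2" by (rule binomial_right_mono)
    moreover have "(\<Sum>i = 1..j - 1. K - i) + ((K - (j - 1)) choose 2) = K choose 2"
      using j by (intro sum_diff_plus_choose_two) linarith
    ultimately show False using c(2) j by linarith
  qed
qed

end
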